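(* Let $\mathcal U$ be a non-principal ultrafilter on $\omega$. Then: (a) $\mathrm{add}(r^0_{\mathcal U}) = \mathfrak p(\mathcal U)$; (b) $\mathrm{cov}(r^0_{\mathcal U}) = \pi\mathfrak p(\mathcal U)$; (c) $\mathrm{non}(r^0_{\mathcal U}) = \pi\chi(\mathcal U)$; (d) $\mathrm{cof}(r^0_{\mathcal U}) = \chi_\sigma(\mathcal U)$.
   Context: $[\omega]^\omega$ denotes the infinite subsets of $\omega$, $[\omega]^{<\omega}$ the finite ones; $A\subseteq^* B$ means $A\setminus B$ is finite. For a non-principal ultrafilter $\mathcal U$ on $\omega$: $\mathfrak p(\mathcal U)=\min\{|\mathcal A|:\mathcal A\subseteq\mathcal U$ and there is no $B\in\mathcal U$ with $B\subseteq^*A$ for all $A\in\mathcal A\}$; $\pi\mathfrak p(\mathcal U)=\min\{|\mathcal A|:\mathcal A\subseteq\mathcal U$ and there is no $B\in[\omega]^\omega$ with $B\subseteq^*A$ for all $A\in\mathcal A\}$; $\pi\chi(\mathcal U)=\min\{|\mathcal A|:\mathcal A\subseteq[\omega]^\omega$ and for every $B\in\mathcal U$ some $A\in\mathcal A$ satisfies $A\subseteq^*B\}$; $\chi_\sigma(\mathcal U)=\min\{|\mathcal A|:\mathcal A$ is a family of countable subsets of $\mathcal U$ such that for every countable $\bar B\subseteq\mathcal U$ there is $\bar A\in\mathcal A$ with: for all $B\in\bar B$ there is $A\in\bar A$ with $A\subseteq^*B\}$. Mathias conditions for $\mathcal U$ are pairs $(r,U)$ with $r\in[\omega]^{<\omega}$,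 $U\in\mathcal U$, $\max(r)<\min(U)$; set $[r,U]=\{A\in[\omega]^\omega: r\subseteq A\subseteq r\cup U\}$. The ideal $r^0_{\mathcal U}$ consists of all $X\subseteq[\omega]^\omega$ such that for every Mathias condition $(r,U)$ there is $V\in\mathcal U$, $V\subseteq U$, with $X\cap[r,V]=\emptyset$. For an ideal $\mathcal I$ on $[\omega]^\omega$ containing singletons: $\mathrm{add}(\mathcal I)$ is the least size of a subfamily of $\mathcal I$ whose union is not in $\mathcal I$; $\mathrm{cov}(\mathcal I)$ the least size of a subfamily of $\mathcal I$ covering the whole space; $\mathrm{non}(\mathcal I)$ the least size of a subset of the space not in $\mathcal I$; $\mathrm{cof}(\mathcal I)$ the least size of a subfamily $\mathcal F\subseteq\mathcal I$ such that every member of $\mathcal I$ is contained in some member of $\mathcal F$. *)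

theory Defs
  imports Main "HOL-Library.Countable_Set"
begin

unbundle cardinal_syntax

section \<open>Least cardinalities\<close>

text \<open>
  The cardinal \<open>min {|A| : P A}\<close>, taken as the cardinality of a witness of least size; cardinals
  over different types are compared with \<open>=o\<close>. The value is meaningful only if \<open>P\<close> is satisfiable,
  which the last section proves for each of the invariants defined below.
\<close>

definition min_card :: "('a set \<Rightarrow> bool) \<Rightarrow> 'a rel" where
  "min_card P = |SOME A. P A \<and> (\<forall>B. P B \<longrightarrow> |A| \<le>o |B| )|"

lemma min_card_attained:
  assumes "\<exists>A. P A"
  obtains A where "P A" "min_card P = |A|" "\<And>B. P B \<Longrightarrow> |A| \<le>o |B|"
proof -
  let ?least = "\<lambda>A. P A \<and> (\<forall>B. P B \<longrightarrow> |A| \<le>o |B| )"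
  have "\<exists>r \<in> card_of ` Collect P. \<forall>r' \<in> card_of ` Collect P. r \<le>o r'"
    by (rule exists_minim_Card_order) (use assms card_of_Card_order in auto)
  then have "\<exists>A. ?least A" by simp
  then have "?least (SOME A. ?least A)" by (rule someI_ex)
  then show thesis using that unfolding min_card_def by blast
qed


section \<open>Cardinal invariants of an ultrafilter on the natural numbers\<close>

definition infinite_sets :: "nat set set" where
  "infinite_sets = {A. infinite A}"

definition almost_subset :: "nat set \<Rightarrow> nat set \<Rightarrow> bool" (infix "\<subseteq>\<^sup>*" 50) where
  "A \<subseteq>\<^sup>* B \<longleftrightarrow> finite (A - B)"

definition nonprincipal_ultrafilter :: "nat set set \<Rightarrow> bool" where
  "nonprincipal_ultrafilter U \<longleftrightarrow>
     UNIV \<in> U \<and> {} \<notin> U \<and>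
     (\<forall>A B. A \<in> U \<longrightarrow> B \<in> U \<longrightarrow> A \<inter> B \<in> U) \<and>
     (\<forall>A B. A \<in> U \<longrightarrow> A \<subseteq> B \<longrightarrow> B \<in> U) \<and>
     (\<forall>A. A \<in> U \<or> - A \<in> U) \<and>
     (\<forall>n. U \<noteq> {A. n \<in> A})"

definition p_number :: "nat set set \<Rightarrow> nat set rel" where
  "p_number U = min_card (\<lambda>\<A>. \<A> \<subseteq> U \<and> \<not> (\<exists>B\<in>U. \<forall>A\<in>\<A>. B \<subseteq>\<^sup>* A))"

definition pi_p_number :: "nat set set \<Rightarrow> nat set rel" where
  "pi_p_number U = min_card (\<lambda>\<A>. \<A> \<subseteq> U \<and> \<not> (\<exists>B\<in>infinite_sets. \<forall>A\<in>\<A>. B \<subseteq>\<^sup>* A))"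

definition pi_character :: "nat set set \<Rightarrow> nat set rel" where
  "pi_character U = min_card (\<lambda>\<A>. \<A> \<subseteq> infinite_sets \<and> (\<forall>B\<in>U. \<exists>A\<in>\<A>. A \<subseteq>\<^sup>* B))"

definition sigma_character :: "nat set set \<Rightarrow> nat set set rel" where
  "sigma_character U = min_card (\<lambda>\<A>. (\<forall>\<A>'\<in>\<A>. countable \<A>' \<and> \<A>' \<subseteq> U) \<and>
     (\<forall>\<B>. countable \<B> \<and> \<B> \<subseteq> U \<longrightarrow> (\<exists>\<A>'\<in>\<A>. \<forall>B\<in>\<B>. \<exists>A\<in>\<A>'. A \<subseteq>\<^sup>* B)))"


section \<open>The Mathias ideal\<close>

text \<open>For \<open>r = {}\<close> the requirement \<open>max r < min U\<close> is vacuous.\<close>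

definition mathias_condition :: "nat set set \<Rightarrow> nat set \<Rightarrow> nat set \<Rightarrow> bool" where
  "mathias_condition \<U> r U \<longleftrightarrow> finite r \<and> U \<in> \<U> \<and> (\<forall>m\<in>r. \<forall>n\<in>U. m < n)"

definition mathias_set :: "nat set \<Rightarrow> nat set \<Rightarrow> nat set set" where
  "mathias_set r U = {A \<in> infinite_sets. r \<subseteq> A \<and> A \<subseteq> r \<union> U}"

definition mathias_ideal :: "nat set set \<Rightarrow> nat set set set" where
  "mathias_ideal \<U> = {X. X \<subseteq> infinite_sets \<and>
     (\<forall>r U. mathias_condition \<U> r U \<longrightarrow> (\<exists>V\<in>\<U>. V \<subseteq> U \<and> X \<inter> mathias_set r V = {}))}"


section \<open>Cardinal invariants of an ideal \<open>I\<close> on a space \<open>S\<close>\<close>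

definition ideal_add :: "'a set set \<Rightarrow> 'a set rel" where
  "ideal_add I = min_card (\<lambda>F. F \<subseteq> I \<and> \<Union>F \<notin> I)"

definition ideal_cov :: "'a set \<Rightarrow> 'a set set \<Rightarrow> 'a set rel" where
  "ideal_cov S I = min_card (\<lambda>F. F \<subseteq> I \<and> S \<subseteq> \<Union>F)"

definition ideal_non :: "'a set \<Rightarrow> 'a set set \<Rightarrow> 'a rel" where
  "ideal_non S I = min_card (\<lambda>Y. Y \<subseteq> S \<and> Y \<notin> I)"

definition ideal_cof :: "'a set set \<Rightarrow> 'a set rel" where
  "ideal_cof I = min_card (\<lambda>F. F \<subseteq> I \<and> (\<forall>X\<in>I. \<exists>Y\<in>F. X \<subseteq> Y))"


section \<open>The minima are attained\<close>

lemma nonprincipal_ultrafilter_infinite: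
  assumes U: "nonprincipal_ultrafilter U" and A: "A \<in> U"
  shows "infinite A"
proof
  assume "finite A"
  have no_singleton: "{n} \<notin> U" for n
  proof
    assume n: "{n} \<in> U"
    have "B \<in> U \<longleftrightarrow> n \<in> B" for B
    proof
      assume "B \<in> U"
      with n U have "{n} \<inter> B \<in> U" "{} \<notin> U"
        unfolding nonprincipal_ultrafilter_def by blast+
      then show "n \<in> B" by (cases "n \<in> B") auto
    next
      assume "n \<in> B"
      then have "{n} \<subseteq> B" by simp
      with n U show "B \<in> U"
        unfolding nonprincipal_ultrafilter_def by blast
    qed
    then have "U = {B. n \<in> B}" by blast
    with U show False unfolding nonprincipal_ultrafilter_def by blast
  qed
  from \<open>finite A\<close> have "A \<notin> U"
  proof (induction A rule: finite_induct)
    case empty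
    then show ?case using U unfolding nonprincipal_ultrafilter_def by blast
  next
    case (insert n F)
    then have "- F \<in> U" "- {n} \<in> U"
      using U no_singleton unfolding nonprincipal_ultrafilter_def by blast+
    then have "- F \<inter> - {n} \<in> U"
      using U unfolding nonprincipal_ultrafilter_def by blast
    moreover have "(- F \<inter> - {n}) \<inter> insert n F = {}" by auto
    ultimately show ?case
      using U unfolding nonprincipal_ultrafilter_def by metis
  qed
  with A show False by contradiction
qed

lemma nonprincipal_ultrafilter_splits:
  assumes U: "nonprincipal_ultrafilter U" and B: "infinite B"
  obtains A where "A \<in> U" "infinite (B - A)"
proof -
  obtain f :: "nat \<Rightarrow> nat" where f: "inj f" "range f \<subseteq> B"
    using B infinite_countable_subset by blast
  let ?E = "f ` {n. even n}" and ?O = "f ` {n. odd n}"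
  have "range (\<lambda>n. f (2 * n)) \<subseteq> ?E" "range (\<lambda>n. f (2 * n + 1)) \<subseteq> ?O"
    by auto
  moreover have "inj (\<lambda>n. f (2 * n))" "inj (\<lambda>n. f (2 * n + 1))"
    by (auto intro!: injI dest: injD[OF f(1)])
  ultimately have E: "infinite ?E" and O: "infinite ?O"
    using range_inj_infinite finite_subset by metis+
  have "?O \<subseteq> B - ?E"
    using f by (auto simp: inj_def)
  then have BE: "infinite (B - ?E)"
    using O finite_subset by blast
  show thesis
  proof (cases "?E \<in> U")
    case True
    then show thesis using BE that by blast
  next
    case False
    then have "- ?E \<in> U"
      using U unfolding nonprincipal_ultrafilter_def by blast
    moreover have "?E \<subseteq> B - (- ?E)"
      using f by auto
    then have "infinite (B - (- ?E))"
      using E finite_subset by blast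
    ultimately show thesis using that by blast
  qed
qed

lemma singleton_in_mathias_ideal:
  assumes U: "nonprincipal_ultrafilter \<U>" and A: "A \<in> infinite_sets"
  shows "{A} \<in> mathias_ideal \<U>"
proof -
  obtain A' where A': "A' \<in> \<U>" "infinite (A - A')"
    using nonprincipal_ultrafilter_splits[OF U] A unfolding infinite_sets_def by blast
  have "\<exists>V\<in>\<U>. V \<subseteq> U \<and> {A} \<inter> mathias_set r V = {}" if "mathias_condition \<U> r U" for r U
  proof (intro bexI conjI)
    from that have "finite r" "U \<in> \<U>"
      unfolding mathias_condition_def by auto
    then show "U \<inter> A' \<in> \<U>"
      using U A' unfolding nonprincipal_ultrafilter_def by blast
    have "\<not> A \<subseteq> r \<union> (U \<inter> A')"
    proof
      assume "A \<subseteq> r \<union> (U \<inter> A')"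
      then have "A - A' \<subseteq> r" by blast
      with \<open>finite r\<close> A' show False using finite_subset by blast
    qed
    then show "{A} \<inter> mathias_set r (U \<inter> A') = {}"
      unfolding mathias_set_def by blast
  qed blast
  with A show ?thesis unfolding mathias_ideal_def by blast
qed

lemma infinite_sets_notin_mathias_ideal:
  assumes U: "nonprincipal_ultrafilter \<U>"
  shows "infinite_sets \<notin> mathias_ideal \<U>"
proof
  assume "infinite_sets \<in> mathias_ideal \<U>"
  moreover have "mathias_condition \<U> {} UNIV"
    using U unfolding mathias_condition_def nonprincipal_ultrafilter_def by blast
  ultimately obtain V where V: "V \<in> \<U>" "infinite_sets \<inter> mathias_set {} V = {}"
    unfolding mathias_ideal_def by blast
  have "V \<in> infinite_sets \<inter> mathias_set {} V"
    using nonprincipal_ultrafilter_infinite[OF U V(1)]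
    unfolding mathias_set_def infinite_sets_def by blast
  with V show False by blast
qed

lemma Union_mathias_ideal:
  assumes "nonprincipal_ultrafilter \<U>"
  shows "\<Union>(mathias_ideal \<U>) = infinite_sets"
proof
  show "\<Union>(mathias_ideal \<U>) \<subseteq> infinite_sets"
    unfolding mathias_ideal_def by blast
  show "infinite_sets \<subseteq> \<Union>(mathias_ideal \<U>)"
    using singleton_in_mathias_ideal[OF assms] by blast
qed

context
  fixes U :: "nat set set"
  assumes U: "nonprincipal_ultrafilter U"
begin

lemma pi_p_number_exists:
  "\<exists>\<A>. \<A> \<subseteq> U \<and> \<not> (\<exists>B\<in>infinite_sets. \<forall>A\<in>\<A>. B \<subseteq>\<^sup>* A)"
proof (intro exI[of _ U] conjI notI)
  assume "\<exists>B\<in>infinite_sets. \<forall>A\<in>U. B \<subseteq>\<^sup>* A"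
  then obtain B where B: "infinite B" "\<forall>A\<in>U. finite (B - A)"
    unfolding almost_subset_def infinite_sets_def by blast
  obtain A where "A \<in> U" "infinite (B - A)"
    using nonprincipal_ultrafilter_splits[OF U B(1)] by blast
  with B show False by blast
qed simp

lemma p_number_exists: "\<exists>\<A>. \<A> \<subseteq> U \<and> \<not> (\<exists>B\<in>U. \<forall>A\<in>\<A>. B \<subseteq>\<^sup>* A)"
proof -
  have "U \<subseteq> infinite_sets"
    using nonprincipal_ultrafilter_infinite[OF U] unfolding infinite_sets_def by blast
  with pi_p_number_exists show ?thesis by blast
qed

lemma pi_character_exists:
  "\<exists>\<A>. \<A> \<subseteq> infinite_sets \<and> (\<forall>B\<in>U. \<exists>A\<in>\<A>. A \<subseteq>\<^sup>* B)"
proof (intro exI[of _ infinite_sets] conjI ballI)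
  fix B assume "B \<in> U"
  then show "\<exists>A\<in>infinite_sets. A \<subseteq>\<^sup>* B"
    using nonprincipal_ultrafilter_infinite[OF U]
    unfolding almost_subset_def infinite_sets_def by (intro bexI[of _ B]) auto
qed simp

lemma sigma_character_exists:
  "\<exists>\<A>. (\<forall>\<A>'\<in>\<A>. countable \<A>' \<and> \<A>' \<subseteq> U) \<and>
     (\<forall>\<B>. countable \<B> \<and> \<B> \<subseteq> U \<longrightarrow> (\<exists>\<A>'\<in>\<A>. \<forall>B\<in>\<B>. \<exists>A\<in>\<A>'. A \<subseteq>\<^sup>* B))"
proof (intro exI[of _ "{\<B>. countable \<B> \<and> \<B> \<subseteq> U}"] conjI allI impI)
  fix \<B> assume \<B>: "countable \<B> \<and> \<B> \<subseteq> U"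
  show "\<exists>\<A>'\<in>{\<B>. countable \<B> \<and> \<B> \<subseteq> U}. \<forall>B\<in>\<B>. \<exists>A\<in>\<A>'. A \<subseteq>\<^sup>* B"
  proof (intro bexI[of _ \<B>] ballI)
    fix B assume "B \<in> \<B>"
    then show "\<exists>A\<in>\<B>. A \<subseteq>\<^sup>* B"
      unfolding almost_subset_def by (intro bexI[of _ B]) auto
  qed (use \<B> in simp)
qed simp

lemma ideal_add_exists: "\<exists>F. F \<subseteq> mathias_ideal U \<and> \<Union>F \<notin> mathias_ideal U"
  using Union_mathias_ideal[OF U] infinite_sets_notin_mathias_ideal[OF U]
  by (intro exI[of _ "mathias_ideal U"]) simp

lemma ideal_cov_exists: "\<exists>F. F \<subseteq> mathias_ideal U \<and> infinite_sets \<subseteq> \<Union>F"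
  using Union_mathias_ideal[OF U] by (intro exI[of _ "mathias_ideal U"]) simp

lemma ideal_non_exists: "\<exists>Y. Y \<subseteq> infinite_sets \<and> Y \<notin> mathias_ideal U"
  using infinite_sets_notin_mathias_ideal[OF U] by blast

lemma ideal_cof_exists:
  "\<exists>F. F \<subseteq> mathias_ideal U \<and> (\<forall>X\<in>mathias_ideal U. \<exists>Y\<in>F. X \<subseteq> Y)"
  by blast

end

end

theory Submission
  imports Defs
begin

text \<open>
  A set \<open>X\<close> belongs to the Mathias ideal iff there are \<open>V\<^sub>n \<in> U\<close> such that no \<open>A \<in> X\<close> satisfies
  \<open>A \<setminus> n \<subseteq> V\<^sub>n\<close> for any \<open>n\<close>. For \<open>C \<in> U\<close> the sets not almost contained in \<open>C\<close> form a member of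
  the ideal, which yields the upper bounds in (a) and (b); the lower bound in (c) holds because
  a set outside the ideal is itself a \<open>\<pi>\<close>-base.

  The lower bounds in (a) and (b) and the upper bound in (d) are proved separately for P-points and
  for other \<open>U\<close>. If \<open>U\<close> is a P-point, pick a
  pseudointersection \<open>B \<in> U\<close> of the \<open>V\<^sub>n\<close>, say \<open>B \<setminus> g n \<subseteq> V\<^sub>n\<close>, and a \<open>C \<in> U\<close> that misses
  \<open>[n, g n)\<close> for infinitely many \<open>n\<close>: then no member of \<open>X\<close> is almost contained in \<open>B \<inter> C\<close>, so
  the ideal is generated by the sets of the simple form above. If it is not, there are \<open>W\<^sub>n \<in> U\<close> such that for every \<open>g\<close> some
  \<open>D \<in> U\<close> has the property that any almost subset of \<open>D\<close> meeting all \<open>W\<^sub>n\<close> computes a function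
  eventually dominating \<open>g\<close>. This applies to the almost subsets of \<open>D\<close> in \<open>U\<close> and to the
  pseudointersections of \<open>D\<close> and the \<open>W\<^sub>n\<close>; thus \<open>\<dd> \<le> \<chi>\<^sub>\<sigma>(U)\<close> and \<open>\<pi>\<pp>(U) \<le> \<bb>\<close>, which takes
  care of the finite errors in almost inclusions.
\<close>

section \<open>Cardinalities\<close>

text \<open>The common frame of all eight inequalities: a witness for \<open>Q\<close> is turned
  into a witness for \<open>P\<close> of no larger size, possibly over another type. As
  \<open>min_card\<close> rests on \<open>SOME\<close>, both properties must be satisfiable.\<close>

lemma min_card_leI:
  assumes "\<exists>A. P A" "\<exists>B. Q B" and le: "\<And>B. Q B \<Longrightarrow> \<exists>A. P A \<and> |A| \<le>o |B|"
  shows "min_card P \<le>o min_card Q"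
proof -
  obtain A where A: "min_card P = |A|" "\<And>A'. P A' \<Longrightarrow> |A| \<le>o |A'|"
    using min_card_attained[OF assms(1)] by metis
  obtain B where B: "Q B" "min_card Q = |B|"
    using min_card_attained[OF assms(2)] by metis
  obtain A' where "P A'" "|A'| \<le>o |B|" using le[OF B(1)] by blast
  then show ?thesis using A B ordLeq_transitive by metis
qed

lemma countable_ordLeq_infinite:
  assumes "countable A" "infinite B"
  shows "|A| \<le>o |B|"
proof -
  have "|A| \<le>o |UNIV :: nat set|"
    using assms(1) card_of_ordLeq[of A "UNIV :: nat set"] unfolding countable_def by auto
  then show ?thesis using assms(2) infinite_iff_card_of_nat ordLeq_transitive by blast
qed

lemma UN_countable_ordLeq:
  assumes "infinite B" "|I| \<le>o |B|" "\<And>i. i \<in> I \<Longrightarrow> countable (A i)"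
  shows "|\<Union>i\<in>I. A i| \<le>o |B|"
  using assms by (intro card_of_UNION_ordLeq_infinite) (auto intro: countable_ordLeq_infinite)

section \<open>Almost inclusion\<close>

lemma almost_subset_bound:
  "A \<subseteq>\<^sup>* B \<longleftrightarrow> (\<exists>n. A - {..<n} \<subseteq> B)"
proof
  assume "A \<subseteq>\<^sup>* B"
  then obtain n where "A - B \<subseteq> {..<n}"
    unfolding almost_subset_def using finite_nat_bounded by blast
  then show "\<exists>n. A - {..<n} \<subseteq> B" by blast
next
  assume "\<exists>n. A - {..<n} \<subseteq> B"
  then obtain n where "A - B \<subseteq> {..<n}" by blast
  then show "A \<subseteq>\<^sup>* B" unfolding almost_subset_def using finite_subset by blast
qed

lemma almost_subset_trans: "A \<subseteq>\<^sup>* B \<Longrightarrow> B \<subseteq>\<^sup>* C \<Longrightarrow> A \<subseteq>\<^sup>* C"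
  unfolding almost_subset_def by (rule finite_subset[of _ "(A - B) \<union> (B - C)"]) auto

lemma subset_imp_almost_subset: "A \<subseteq> B \<Longrightarrow> A \<subseteq>\<^sup>* B"
  unfolding almost_subset_def by (simp add: Diff_eq_empty_iff[THEN iffD2])

definition almost_escaping :: "nat set \<Rightarrow> nat set set" where
  "almost_escaping C = {A \<in> infinite_sets. \<not> A \<subseteq>\<^sup>* C}"

lemma almost_escaping_mono: "D \<subseteq>\<^sup>* C \<Longrightarrow> almost_escaping C \<subseteq> almost_escaping D"
  unfolding almost_escaping_def using almost_subset_trans by blast

text \<open>Cut the naturals into consecutive intervals \<open>[a, b)\<close> with \<open>b \<ge> g a\<close> and let \<open>E\<close> be the union
  of every other one.\<close>

lemma alternating_gaps:
  fixes g :: "nat \<Rightarrow> nat"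
  obtains E where "\<And>N. \<exists>n\<ge>N. E \<inter> {n..<g n} = {}" "\<And>N. \<exists>n\<ge>N. - E \<inter> {n..<g n} = {}"
proof -
  \<comment> \<open>The \<open>Suc x\<close> keeps \<open>a\<close> strictly increasing where
    \<open>g x \<le> x\<close>.\<close>
  define a where "a = rec_nat 0 (\<lambda>_ x. max (Suc x) (g x))"
  have a_Suc: "a (Suc k) = max (Suc (a k)) (g (a k))" for k by (simp add: a_def)
  have sm: "strict_mono a" by (rule strict_mono_Suc_iff[THEN iffD2]) (simp add: a_Suc less_max_iff_disj)
  have uniq: "j = k" if "a j \<le> x" "x < a (Suc j)" "a k \<le> x" "x < a (Suc k)" for j k x
  proof -
    have "a j < a (Suc k)" "a k < a (Suc j)" using that by linarith+
    then show "j = k" using strict_mono_less[OF sm] by (meson less_Suc_eq_le order_antisym)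
  qed
  define E where "E = {x. \<exists>k. even k \<and> a k \<le> x \<and> x < a (Suc k)}"
  have ge: "k \<le> a k" for k using strict_mono_imp_increasing[OF sm] .
  show thesis
  proof
    fix N
    \<comment> \<open>By the choice of \<open>a\<close>, the interval that starts at
      \<open>a k\<close> contains \<open>{a k..<g (a k)}\<close>. For odd \<open>k\<close> it is
      omitted by \<open>E\<close>, for even \<open>k\<close> by \<open>- E\<close>; the index
      \<open>2 * N + 1\<close> or \<open>2 * N\<close> pushes the gap past \<open>N\<close>.\<close>
    have "E \<inter> {a (2 * N + 1)..<g (a (2 * N + 1))} = {}"
    proof -
      have "odd k" if "a k \<le> x" "x < a (Suc k)" "a (2*N+1) \<le> x" "x < g (a (2 * N + 1))" for k x
        using uniq[of k x "2*N+1"] that a_Suc[of "2*N+1"] by auto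
      then show ?thesis unfolding E_def by fastforce
    qed
    moreover have "N \<le> a (2 * N + 1)" using ge[of "2*N+1"] by linarith
    ultimately show "\<exists>n\<ge>N. E \<inter> {n..<g n} = {}" by blast
    have "x \<in> E" if "a (2*N) \<le> x" "x < g (a (2 * N))" for x
      unfolding E_def using that a_Suc[of "2*N"] by (auto intro!: exI[of _ "2*N"])
    then have "- E \<inter> {a (2 * N)..<g (a (2 * N))} = {}" by fastforce
    moreover have "N \<le> a (2 * N)" using ge[of "2*N"] by linarith
    ultimately show "\<exists>n\<ge>N. - E \<inter> {n..<g n} = {}" by blast
  qed
qed

text \<open>Elements of \<open>A\<close> from \<open>n\<close> on are at least \<open>g n\<close>,
  hence past the finite error \<open>g' n\<close> of \<open>B\<close> with respect to
  \<open>V\<close>. A gap thus turns almost inclusion into inclusion from \<open>n\<close>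
  on.\<close>

lemma gapped_no_initial_fit:
  fixes A :: "nat set"
  assumes "A \<subseteq> B" and gap: "A \<inter> {n..<g n} = {}" and "B - {..<g' n} \<subseteq> V" "g' n \<le> g n"
  shows "A - {..<n} \<subseteq> V"
proof
  fix x assume x: "x \<in> A - {..<n}"
  then have "x \<notin> {n..<g n}" using gap by blast
  then have "x \<notin> {..<g' n}" using x assms(4) by auto
  then show "x \<in> V" using x assms by auto
qed

section \<open>The ideal and P-points\<close>

definition p_point :: "nat set set \<Rightarrow> bool" where
  "p_point U \<longleftrightarrow> (\<forall>V :: nat \<Rightarrow> nat set. (\<forall>n. V n \<in> U) \<longrightarrow> (\<exists>B\<in>U. \<forall>n. B \<subseteq>\<^sup>* V n))"

context
  fixes U :: "nat set set"
  assumes U: "nonprincipal_ultrafilter U"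
begin

lemma UNIV_in: "UNIV \<in> U"
  and empty_notin: "{} \<notin> U"
  and Int_in: "A \<in> U \<Longrightarrow> B \<in> U \<Longrightarrow> A \<inter> B \<in> U"
  and superset_in: "A \<in> U \<Longrightarrow> A \<subseteq> B \<Longrightarrow> B \<in> U"
  and in_or_Compl_in: "A \<in> U \<or> - A \<in> U"
  using U unfolding nonprincipal_ultrafilter_def by blast+

lemma INT_in: "finite I \<Longrightarrow> (\<And>i. i \<in> I \<Longrightarrow> V i \<in> U) \<Longrightarrow> (\<Inter>i\<in>I. V i) \<in> U"
  by (induction I rule: finite_induct) (auto intro: UNIV_in Int_in)

lemma infinite_in: "A \<in> U \<Longrightarrow> infinite A"
  using nonprincipal_ultrafilter_infinite[OF U] .

lemma cofinite_in: "finite (- A) \<Longrightarrow> A \<in> U"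
  using in_or_Compl_in[of A] infinite_in by blast

lemma splits: "infinite B \<Longrightarrow> \<exists>A\<in>U. infinite (B - A)"
  using nonprincipal_ultrafilter_splits[OF U] by metis

lemma tail_in: "A \<in> U \<Longrightarrow> A - {..<n} \<in> U"
  unfolding Diff_eq by (rule Int_in) (auto intro: cofinite_in)

text \<open>Only finitely many stems are contained in \<open>{..<n}\<close>, so the sets of
  \<open>U\<close> that avoid \<open>X\<close> for each of them can be intersected to a single
  \<open>V n\<close>. Conversely, \<open>V n\<close> serves every stem contained in
  \<open>{..<n}\<close>.\<close>

lemma mathias_ideal_iff:
  "X \<in> mathias_ideal U \<longleftrightarrow> X \<subseteq> infinite_sets \<and>
     (\<exists>V. range V \<subseteq> U \<and> (\<forall>A\<in>X. \<forall>n. \<not> A - {..<n} \<subseteq> V n))"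
proof (intro iffI conjI)
  assume X: "X \<in> mathias_ideal U"
  then show "X \<subseteq> infinite_sets" unfolding mathias_ideal_def by blast
  have "\<exists>V\<in>U. X \<inter> mathias_set s V = {}" if "finite s" for s
  proof -
    obtain n where "s \<subseteq> {..<n}" using finite_nat_bounded[OF \<open>finite s\<close>] by blast
    then have "mathias_condition U s (UNIV - {..<n})"
      using that tail_in[OF UNIV_in] unfolding mathias_condition_def by force
    then show ?thesis using X unfolding mathias_ideal_def by blast
  qed
  then obtain W where W: "\<And>s. finite s \<Longrightarrow> W s \<in> U \<and> X \<inter> mathias_set s (W s) = {}" by metis
  define V where "V n = (\<Inter>s\<in>Pow {..<n}. W s)" for n :: nat
  have "V n \<in> U" for n unfolding V_def
    by (rule INT_in) (auto intro: W[THEN conjunct1] finite_subset)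
  moreover have "\<not> A - {..<n} \<subseteq> V n" if "A \<in> X" for A n
  proof
    assume "A - {..<n} \<subseteq> V n"
    then have "A - {..<n} \<subseteq> W (A \<inter> {..<n})" unfolding V_def by blast
    then have "A \<in> mathias_set (A \<inter> {..<n}) (W (A \<inter> {..<n}))"
      using that \<open>X \<subseteq> infinite_sets\<close> unfolding mathias_set_def by blast
    then show False using W[of "A \<inter> {..<n}"] that by blast
  qed
  ultimately show "\<exists>V. range V \<subseteq> U \<and> (\<forall>A\<in>X. \<forall>n. \<not> A - {..<n} \<subseteq> V n)"
    by blast
next
  assume *: "X \<subseteq> infinite_sets \<and> (\<exists>V. range V \<subseteq> U \<and> (\<forall>A\<in>X. \<forall>n. \<not> A - {..<n} \<subseteq> V n))"
  then obtain V where V: "range V \<subseteq> U" "\<forall>A\<in>X. \<forall>n. \<not> A - {..<n} \<subseteq> V n" by blast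
  have "\<exists>W\<in>U. W \<subseteq> Y \<and> X \<inter> mathias_set r W = {}" if r: "mathias_condition U r Y" for r Y
  proof -
    have "finite r" "Y \<in> U" using r unfolding mathias_condition_def by auto
    obtain n where n: "r \<subseteq> {..<n}" using finite_nat_bounded[OF \<open>finite r\<close>] by blast
    have "A \<notin> X" if "A \<in> mathias_set r (V n \<inter> Y)" for A
    proof
      assume "A \<in> X"
      have "A - {..<n} \<subseteq> V n" using n that unfolding mathias_set_def by blast
      then show False using V(2) \<open>A \<in> X\<close> by blast
    qed
    moreover have "V n \<inter> Y \<in> U" using V(1) \<open>Y \<in> U\<close> Int_in by blast
    ultimately show ?thesis by blast
  qed
  then show "X \<in> mathias_ideal U" using * unfolding mathias_ideal_def by blast
qed

lemma mathias_idealD: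
  "X \<in> mathias_ideal U \<Longrightarrow> \<exists>V. (\<forall>n. V n \<in> U) \<and> (\<forall>A\<in>X. \<forall>n. \<not> A - {..<n} \<subseteq> V n)"
  unfolding mathias_ideal_iff image_subset_iff by simp

lemma mathias_idealI:
  assumes "X \<subseteq> infinite_sets" "\<And>n. V n \<in> U" "\<And>A n. A \<in> X \<Longrightarrow> \<not> A - {..<n} \<subseteq> V n"
  shows "X \<in> mathias_ideal U"
  unfolding mathias_ideal_iff by (intro conjI exI[of _ V] ballI allI image_subsetI assms)

lemma mathias_ideal_infinite_sets: "X \<in> mathias_ideal U \<Longrightarrow> X \<subseteq> infinite_sets"
  unfolding mathias_ideal_def by simp

lemma mathias_ideal_subset:
  assumes "X \<in> mathias_ideal U" "Y \<subseteq> X"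
  shows "Y \<in> mathias_ideal U"
proof -
  obtain V where V: "\<And>n. V n \<in> U" "\<And>A n. A \<in> X \<Longrightarrow> \<not> A - {..<n} \<subseteq> V n"
    using mathias_idealD[OF assms(1)] by metis
  then show ?thesis
    using mathias_ideal_infinite_sets[OF assms(1)] assms(2) by (intro mathias_idealI[of Y V]) auto
qed

lemma mathias_ideal_Un:
  assumes "X \<in> mathias_ideal U" "Y \<in> mathias_ideal U"
  shows "X \<union> Y \<in> mathias_ideal U"
proof -
  obtain V where V: "\<And>n. V n \<in> U" "\<And>A n. A \<in> X \<Longrightarrow> \<not> A - {..<n} \<subseteq> V n"
    using mathias_idealD[OF assms(1)] by metis
  obtain W where W: "\<And>n. W n \<in> U" "\<And>A n. A \<in> Y \<Longrightarrow> \<not> A - {..<n} \<subseteq> W n"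
    using mathias_idealD[OF assms(2)] by metis
  show ?thesis
  proof (rule mathias_idealI)
    show "X \<union> Y \<subseteq> infinite_sets" using assms by (simp add: mathias_ideal_infinite_sets)
    show "V n \<inter> W n \<in> U" for n using V(1) W(1) by (rule Int_in)
    show "\<not> A - {..<n} \<subseteq> V n \<inter> W n" if "A \<in> X \<union> Y" for A n
      using V(2)[of A n] W(2)[of A n] that by auto
  qed
qed

lemma mathias_ideal_finite_Union:
  "finite F \<Longrightarrow> F \<subseteq> mathias_ideal U \<Longrightarrow> \<Union>F \<in> mathias_ideal U"
proof (induction F rule: finite_induct)
  case empty
  then show ?case by (intro mathias_idealI[of _ "\<lambda>_. UNIV"]) (simp_all add: UNIV_in)
next
  case (insert X F)
  then show ?case by (simp add: mathias_ideal_Un)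
qed

lemma almost_escaping_in_ideal: "C \<in> U \<Longrightarrow> almost_escaping C \<in> mathias_ideal U"
  by (rule mathias_idealI[of _ "\<lambda>_. C"]) (auto simp: almost_escaping_def almost_subset_bound)

lemma p_point_almost_escaping:
  assumes "p_point U" "X \<in> mathias_ideal U"
  shows "\<exists>C\<in>U. X \<subseteq> almost_escaping C"
proof -
  obtain V where V: "\<And>n. V n \<in> U" "\<And>A n. A \<in> X \<Longrightarrow> \<not> A - {..<n} \<subseteq> V n"
    using mathias_idealD[OF assms(2)] by metis
  obtain B where B: "B \<in> U" "\<And>n. B \<subseteq>\<^sup>* V n"
    using assms(1) V(1) unfolding p_point_def by blast
  obtain g where g: "\<And>n. B - {..<g n} \<subseteq> V n"
    using B(2) unfolding almost_subset_bound by metis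
  \<comment> \<open>Both \<open>E\<close> and \<open>- E\<close> have the gaps; \<open>C\<close> is
    the one that belongs to \<open>U\<close>.\<close>
  obtain C where C: "C \<in> U" "\<And>N. \<exists>n\<ge>N. C \<inter> {n..<g n} = {}"
    using alternating_gaps[of g] in_or_Compl_in by metis
  have "\<not> A \<subseteq>\<^sup>* B \<inter> C" if "A \<in> X" for A
  proof
    assume "A \<subseteq>\<^sup>* B \<inter> C"
    then obtain m where m: "A - {..<m} \<subseteq> B \<inter> C" unfolding almost_subset_bound by blast
    \<comment> \<open>A gap at some \<open>n \<ge> m\<close> absorbs the finite error
      \<open>m\<close> of \<open>A\<close>.\<close>
    obtain n where n: "m \<le> n" "C \<inter> {n..<g n} = {}" using C(2) by blast
    have "A - {..<m} - {..<n} \<subseteq> V n"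
      by (rule gapped_no_initial_fit[where B = B and g = g and g' = g]) (use m n g in auto)
    then have "A - {..<n} \<subseteq> V n" using n(1) by auto
    then show False using V(2) that by blast
  qed
  moreover have "X \<subseteq> infinite_sets" using mathias_ideal_infinite_sets[OF assms(2)] .
  ultimately show ?thesis
    unfolding almost_escaping_def using Int_in[OF B(1) C(1)] by blast
qed

text \<open>The least element of \<open>B \<inter> W n\<close> is at least \<open>g n\<close> once
  it lies in \<open>\<Phi> g\<close>, by the definition of \<open>\<Phi>\<close>. The function
  \<open>d B\<close> depends on \<open>B\<close> alone, so one \<open>B\<close> almost contained in
  many sets \<open>\<Phi> g\<close> dominates all these \<open>g\<close> at once.\<close>

lemma not_p_point_dominating:
  assumes "\<not> p_point U"
  shows "\<exists>(W :: nat \<Rightarrow> nat set) \<Phi> (d :: nat set \<Rightarrow> nat \<Rightarrow> nat). (\<forall>n. W n \<in> U) \<and> (\<forall>g. \<Phi> g \<in> U) \<and>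
    (\<forall>B g. (\<forall>n. B \<inter> W n \<noteq> {}) \<longrightarrow> B \<subseteq>\<^sup>* \<Phi> g \<longrightarrow> (\<exists>N. \<forall>n\<ge>N. g n \<le> d B n))"
proof -
  obtain V :: "nat \<Rightarrow> nat set" where V: "\<And>n. V n \<in> U" "\<And>B. B \<in> U \<Longrightarrow> \<exists>n. \<not> B \<subseteq>\<^sup>* V n"
    using assms unfolding p_point_def by metis
  \<comment> \<open>Removing \<open>{..<n}\<close> forces \<open>n \<le> d B n\<close>, so that for
    large \<open>n\<close> the value \<open>d B n\<close> is past the finite error of
    \<open>B\<close> in \<open>\<Phi> g\<close>.\<close>
  define W where "W n = (\<Inter>i\<in>{..<n}. V i) - {..<n}" for n
  define \<Phi> where "\<Phi> g = {m. \<forall>n. m \<in> W n \<longrightarrow> g n \<le> m}" for g :: "nat \<Rightarrow> nat"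
  define d where "d B n = (LEAST m. m \<in> B \<inter> W n)" for B n
  show ?thesis
  proof (intro exI[of _ W] exI[of _ \<Phi>] exI[of _ d] conjI allI impI)
    show "W n \<in> U" for n unfolding W_def by (intro tail_in INT_in V) simp
    show "\<Phi> g \<in> U" for g
    proof (rule ccontr)
      assume "\<Phi> g \<notin> U"
      then have "- \<Phi> g \<in> U" using in_or_Compl_in by blast
      then obtain i where i: "\<not> - \<Phi> g \<subseteq>\<^sup>* V i" using V(2) by blast
      \<comment> \<open>A point outside \<open>V i\<close> lies in no \<open>W n\<close> with
        \<open>n > i\<close>, so only the finitely many \<open>n \<le> i\<close> can exclude it from
        \<open>\<Phi> g\<close>. Thus \<open>- \<Phi> g\<close> would be a pseudointersection in
        \<open>U\<close> of all \<open>V i\<close>.\<close>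
      have "- \<Phi> g - V i \<subseteq> (\<Union>n\<le>i. {..<g n})"
      proof
        fix m assume m: "m \<in> - \<Phi> g - V i"
        then obtain n where n: "m \<in> W n" "m < g n" unfolding \<Phi>_def by auto
        then have "n \<le> i" using m unfolding W_def by (meson DiffD1 DiffD2 INT_E lessThan_iff not_le)
        then show "m \<in> (\<Union>n\<le>i. {..<g n})" using n by blast
      qed
      then have "finite (- \<Phi> g - V i)" by (rule finite_subset) simp
      then show False using i unfolding almost_subset_def by blast
    qed
    fix B g assume B: "\<forall>n. B \<inter> W n \<noteq> {}" and le: "B \<subseteq>\<^sup>* \<Phi> g"
    then obtain N where N: "B - {..<N} \<subseteq> \<Phi> g" unfolding almost_subset_bound by blast
    have "g n \<le> d B n" if "N \<le> n" for n
    proof -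
      have d: "d B n \<in> B \<inter> W n" unfolding d_def using spec[OF B, of n] by (metis LeastI ex_in_conv)
      then have "n \<le> d B n" unfolding W_def by simp
      then have "d B n \<in> \<Phi> g" using d N that by auto
      then show ?thesis using d unfolding \<Phi>_def by blast
    qed
    then show "\<exists>N. \<forall>n\<ge>N. g n \<le> d B n" by blast
  qed
qed

section \<open>The four equalities\<close>

lemma add_le_p: "ideal_add (mathias_ideal U) \<le>o p_number U"
  unfolding ideal_add_def p_number_def
proof (rule min_card_leI[OF ideal_add_exists[OF U] p_number_exists[OF U]])
  fix \<A> assume \<A>: "\<A> \<subseteq> U \<and> \<not> (\<exists>B\<in>U. \<forall>A\<in>\<A>. B \<subseteq>\<^sup>* A)"
  have "\<Union>(almost_escaping ` \<A>) \<notin> mathias_ideal U"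
  proof
    assume "\<Union>(almost_escaping ` \<A>) \<in> mathias_ideal U"
    then obtain V where V: "\<And>n. V n \<in> U"
      "\<And>A n. A \<in> \<Union>(almost_escaping ` \<A>) \<Longrightarrow> \<not> A - {..<n} \<subseteq> V n"
      using mathias_idealD by metis
    \<comment> \<open>\<open>V 0\<close> fits into itself at \<open>n = 0\<close>, so it escapes no
      member of \<open>\<A>\<close> and is a pseudointersection in \<open>U\<close>.\<close>
    have "V 0 \<notin> \<Union>(almost_escaping ` \<A>)" using V(2)[of "V 0" 0] by auto
    then have "\<forall>A\<in>\<A>. V 0 \<subseteq>\<^sup>* A"
      using infinite_in[OF V(1)] unfolding almost_escaping_def infinite_sets_def by blast
    then show False using \<A> V(1) by blast
  qed
  moreover have "almost_escaping ` \<A> \<subseteq> mathias_ideal U" using \<A> almost_escaping_in_ideal by blast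
  ultimately show "\<exists>F. (F \<subseteq> mathias_ideal U \<and> \<Union>F \<notin> mathias_ideal U) \<and> |F| \<le>o |\<A>|"
    by (intro exI[of _ "almost_escaping ` \<A>"] conjI card_of_image)
qed

lemma p_le_add: "p_number U \<le>o ideal_add (mathias_ideal U)"
  unfolding ideal_add_def p_number_def
proof (rule min_card_leI[OF p_number_exists[OF U] ideal_add_exists[OF U]])
  fix F assume F: "F \<subseteq> mathias_ideal U \<and> \<Union>F \<notin> mathias_ideal U"
  show "\<exists>\<A>. (\<A> \<subseteq> U \<and> \<not> (\<exists>B\<in>U. \<forall>A\<in>\<A>. B \<subseteq>\<^sup>* A)) \<and> |\<A>| \<le>o |F|"
  proof (cases "p_point U")
    case True
    then have "\<forall>X\<in>F. \<exists>C. C \<in> U \<and> X \<subseteq> almost_escaping C"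
      using p_point_almost_escaping F by blast
    then obtain C where C: "\<And>X. X \<in> F \<Longrightarrow> C X \<in> U \<and> X \<subseteq> almost_escaping (C X)"
      by metis
    have False if B: "B \<in> U" "\<forall>A\<in>C ` F. B \<subseteq>\<^sup>* A" for B
    proof -
      have "\<Union>F \<subseteq> almost_escaping B" using B C almost_escaping_mono by blast
      then show False using F almost_escaping_in_ideal[OF B(1)] mathias_ideal_subset by blast
    qed
    moreover have "C ` F \<subseteq> U" using C by blast
    ultimately show ?thesis using card_of_image[of C F] by (intro exI[of _ "C ` F"]) blast
  next
    case False
    \<comment> \<open>A countable family witnesses \<open>p_number U\<close> here, while
      \<open>F\<close> is infinite because the ideal is closed under finite unions.\<close>
    then obtain V :: "nat \<Rightarrow> nat set" where "\<And>n. V n \<in> U" "\<not> (\<exists>B\<in>U. \<forall>n. B \<subseteq>\<^sup>* V n)"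
      unfolding p_point_def by metis
    then have "range V \<subseteq> U" "\<not> (\<exists>B\<in>U. \<forall>A\<in>range V. B \<subseteq>\<^sup>* A)" by auto
    moreover have "infinite F" using F mathias_ideal_finite_Union by blast
    ultimately show ?thesis
      using countable_ordLeq_infinite[of "range V" F] by (intro exI[of _ "range V"]) simp
  qed
qed

section \<open>Covering and the \<pi>-pseudointersection number\<close>

lemma cov_le_pi_p: "ideal_cov infinite_sets (mathias_ideal U) \<le>o pi_p_number U"
  unfolding ideal_cov_def pi_p_number_def
proof (rule min_card_leI[OF ideal_cov_exists[OF U] pi_p_number_exists[OF U]])
  fix \<A> assume \<A>: "\<A> \<subseteq> U \<and> \<not> (\<exists>B\<in>infinite_sets. \<forall>A\<in>\<A>. B \<subseteq>\<^sup>* A)"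
  then have "infinite_sets \<subseteq> \<Union>(almost_escaping ` \<A>)" unfolding almost_escaping_def by blast
  moreover have "almost_escaping ` \<A> \<subseteq> mathias_ideal U" using \<A> almost_escaping_in_ideal by blast
  ultimately show "\<exists>F. (F \<subseteq> mathias_ideal U \<and> infinite_sets \<subseteq> \<Union>F) \<and> |F| \<le>o |\<A>|"
    by (intro exI[of _ "almost_escaping ` \<A>"] conjI card_of_image)
qed

lemma pi_p_le_cov: "pi_p_number U \<le>o ideal_cov infinite_sets (mathias_ideal U)"
  unfolding ideal_cov_def pi_p_number_def
proof (rule min_card_leI[OF pi_p_number_exists[OF U] ideal_cov_exists[OF U]], rule ccontr)
  fix F assume F: "F \<subseteq> mathias_ideal U \<and> infinite_sets \<subseteq> \<Union>F"
  assume "\<nexists>\<A>. (\<A> \<subseteq> U \<and> \<not> (\<exists>B\<in>infinite_sets. \<forall>A\<in>\<A>. B \<subseteq>\<^sup>* A)) \<and> |\<A>| \<le>o |F|"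
  then have pseudo: "\<exists>B\<in>infinite_sets. \<forall>A\<in>\<A>. B \<subseteq>\<^sup>* A" if "\<A> \<subseteq> U" "|\<A>| \<le>o |F|" for \<A>
    using that by blast
  have inf: "infinite F"
  proof
    assume "finite F"
    then have "\<Union>F \<in> mathias_ideal U" using F mathias_ideal_finite_Union by simp
    then have "infinite_sets \<in> mathias_ideal U" using F mathias_ideal_subset by simp
    then show False using infinite_sets_notin_mathias_ideal[OF U] by simp
  qed
  show False
  proof (cases "p_point U")
    case True
    then have "\<forall>X\<in>F. \<exists>C. C \<in> U \<and> X \<subseteq> almost_escaping C"
      using p_point_almost_escaping F by blast
    then obtain C where C: "\<And>X. X \<in> F \<Longrightarrow> C X \<in> U \<and> X \<subseteq> almost_escaping (C X)"
      by metis
    then obtain B where B: "B \<in> infinite_sets" "\<forall>A\<in>C ` F. B \<subseteq>\<^sup>* A"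
      using pseudo[of "C ` F"] card_of_image by blast
    then obtain X where "X \<in> F" "B \<in> X" using F by blast
    then show False using B C unfolding almost_escaping_def by blast
  next
    case False
    obtain V where V: "\<And>X n. X \<in> F \<Longrightarrow> V X n \<in> U"
        "\<And>X A n. X \<in> F \<Longrightarrow> A \<in> X \<Longrightarrow> \<not> A - {..<n} \<subseteq> V X n"
    proof -
      have "\<forall>X\<in>F. \<exists>V. (\<forall>n. V n \<in> U) \<and> (\<forall>A\<in>X. \<forall>n. \<not> A - {..<n} \<subseteq> V n)"
        using F mathias_idealD by blast
      then show thesis using that by metis
    qed
    \<comment> \<open>First pseudointersection: \<open>B\<close> is almost contained in every
      \<open>V X n\<close>, with errors recorded by one function \<open>g X\<close> for each
      \<open>X\<close>.\<close>
    have "|\<Union>X\<in>F. range (V X)| \<le>o |F|"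
      by (rule UN_countable_ordLeq[OF inf card_of_mono1]) simp_all
    moreover have "(\<Union>X\<in>F. range (V X)) \<subseteq> U" using V(1) by auto
    ultimately obtain B where B: "B \<in> infinite_sets" "\<forall>A\<in>(\<Union>X\<in>F. range (V X)). B \<subseteq>\<^sup>* A"
      using pseudo by metis
    have "\<exists>m. B - {..<m} \<subseteq> V X n" if "X \<in> F" for X n
      using B(2) that unfolding almost_subset_bound[symmetric] by blast
    then obtain g where g: "\<And>X n. X \<in> F \<Longrightarrow> B - {..<g X n} \<subseteq> V X n"
      by metis
    obtain W :: "nat \<Rightarrow> nat set" and \<Phi> and d :: "nat set \<Rightarrow> nat \<Rightarrow> nat"
      where W: "\<forall>n. W n \<in> U" and \<Phi>: "\<forall>g. \<Phi> g \<in> U"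
      and d: "\<forall>B g. (\<forall>n. B \<inter> W n \<noteq> {}) \<longrightarrow> B \<subseteq>\<^sup>* \<Phi> g \<longrightarrow> (\<exists>N. \<forall>n\<ge>N. g n \<le> d B n)"
      using not_p_point_dominating[OF False] by metis
    \<comment> \<open>Second pseudointersection: \<open>D\<close> gives a single function
      \<open>d D\<close> that eventually dominates all \<open>g X\<close>.\<close>
    have "|\<Union>X\<in>F. insert (\<Phi> (g X)) (range W)| \<le>o |F|"
      by (rule UN_countable_ordLeq[OF inf card_of_mono1]) simp_all
    moreover have "(\<Union>X\<in>F. insert (\<Phi> (g X)) (range W)) \<subseteq> U" using W \<Phi> by blast
    ultimately obtain D where D: "D \<in> infinite_sets" 
        "\<forall>A\<in>(\<Union>X\<in>F. insert (\<Phi> (g X)) (range W)). D \<subseteq>\<^sup>* A"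
      using pseudo by metis
    have "F \<noteq> {}" using inf by auto
    then have "D \<subseteq>\<^sup>* W n" for n using D by blast
    then have DW: "D \<inter> W n \<noteq> {}" for n
      using D(1) unfolding almost_subset_def infinite_sets_def
      by (metis Diff_triv mem_Collect_eq)
    have dom: "\<exists>N. \<forall>n\<ge>N. g X n \<le> d D n" if "X \<in> F" for X
      using d[rule_format, of D "g X"] DW D(2) that by blast
    obtain E where E: "\<And>N. \<exists>n\<ge>N. E \<inter> {n..<d D n} = {}" "\<And>N. \<exists>n\<ge>N. - E \<inter> {n..<d D n} = {}"
      using alternating_gaps by metis
    \<comment> \<open>\<open>B\<close> need not belong to \<open>U\<close>, so the gapped half is
      chosen by its infinite intersection with \<open>B\<close>. The resulting \<open>A\<close> fits
      some \<open>V X n\<close> for every \<open>X\<close> in \<open>F\<close>, hence is not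
      covered.\<close>
    have "infinite (B \<inter> E) \<or> infinite (B \<inter> - E)"
    proof -
      have "B = (B \<inter> E) \<union> (B \<inter> - E)" by blast
      then show ?thesis using B(1) unfolding infinite_sets_def by (metis finite_UnI mem_Collect_eq)
    qed
    then obtain A where A: "infinite A" "A \<subseteq> B" "\<And>N. \<exists>n\<ge>N. A \<inter> {n..<d D n} = {}"
    proof
      assume "infinite (B \<inter> E)"
      moreover have "\<exists>n\<ge>N. (B \<inter> E) \<inter> {n..<d D n} = {}" for N using E(1)[of N] by blast
      ultimately show thesis using that by blast
    next
      assume "infinite (B \<inter> - E)"
      moreover have "\<exists>n\<ge>N. (B \<inter> - E) \<inter> {n..<d D n} = {}" for N using E(2)[of N] by blast
      ultimately show thesis using that by blast
    qed
    then obtain X where X: "X \<in> F" "A \<in> X" using F unfolding infinite_sets_def by blast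
    obtain N where N: "\<forall>n\<ge>N. g X n \<le> d D n" using dom X by blast
    obtain n where n: "n \<ge> N" "A \<inter> {n..<d D n} = {}" using A(3) by blast
    have "A - {..<n} \<subseteq> V X n"
      using gapped_no_initial_fit[where g = "d D" and g' = "g X", OF A(2) n(2) g[OF X(1)]] N n by blast
    then show False using V(2) X by blast
  qed
qed

section \<open>Uniformity and the \<pi>-character\<close>

lemma non_le_pi_character: "ideal_non infinite_sets (mathias_ideal U) \<le>o pi_character U"
  unfolding ideal_non_def pi_character_def
proof (rule min_card_leI[OF ideal_non_exists[OF U] pi_character_exists[OF U]])
  fix \<A> assume \<A>: "\<A> \<subseteq> infinite_sets \<and> (\<forall>B\<in>U. \<exists>A\<in>\<A>. A \<subseteq>\<^sup>* B)"
  have inf: "infinite \<A>"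
  proof
    assume fin: "finite \<A>"
    have "\<forall>A\<in>\<A>. \<exists>W\<in>U. infinite (A - W)"
      using \<A> splits unfolding infinite_sets_def by auto
    then obtain W where W: "\<And>A. A \<in> \<A> \<Longrightarrow> W A \<in> U \<and> infinite (A - W A)" by metis
    then have "(\<Inter>A\<in>\<A>. W A) \<in> U" using fin INT_in by blast
    then obtain A where A: "A \<in> \<A>" "A \<subseteq>\<^sup>* (\<Inter>A\<in>\<A>. W A)" using \<A> by blast
    then have "A \<subseteq>\<^sup>* W A" using almost_subset_trans subset_imp_almost_subset by blast
    then show False using W[OF A(1)] unfolding almost_subset_def by blast
  qed
  \<comment> \<open>Adding all tails turns \<open>A \<subseteq>\<^sup>* V 0\<close> into an
    inclusion that already holds at \<open>n = 0\<close>; since \<open>\<A>\<close> is infinite, the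
    size does not grow.\<close>
  define Y where "Y = (\<Union>A\<in>\<A>. range (\<lambda>n. A - {..<n}))"
  have "|Y| \<le>o |\<A>|" unfolding Y_def by (rule UN_countable_ordLeq[OF inf card_of_mono1]) simp_all
  moreover have "Y \<subseteq> infinite_sets" using \<A> unfolding Y_def infinite_sets_def by auto
  moreover have "Y \<notin> mathias_ideal U"
  proof
    assume "Y \<in> mathias_ideal U"
    then obtain V where V: "\<And>n. V n \<in> U" "\<And>A n. A \<in> Y \<Longrightarrow> \<not> A - {..<n} \<subseteq> V n"
      using mathias_idealD by metis
    obtain A n where "A \<in> \<A>" "A - {..<n} \<subseteq> V 0" using \<A> V(1) unfolding almost_subset_bound by blast
    then show False using V(2)[of "A - {..<n}" 0] unfolding Y_def by auto
  qed
  ultimately show "\<exists>Y. (Y \<subseteq> infinite_sets \<and> Y \<notin> mathias_ideal U) \<and> |Y| \<le>o |\<A>|"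
    by (intro exI[of _ Y] conjI)
qed

lemma pi_character_le_non: "pi_character U \<le>o ideal_non infinite_sets (mathias_ideal U)"
  unfolding ideal_non_def pi_character_def
proof (rule min_card_leI[OF pi_character_exists[OF U] ideal_non_exists[OF U]])
  fix Y assume Y: "Y \<subseteq> infinite_sets \<and> Y \<notin> mathias_ideal U"
  have "\<exists>A\<in>Y. A \<subseteq>\<^sup>* B" if "B \<in> U" for B
  proof (rule ccontr)
    assume "\<not> (\<exists>A\<in>Y. A \<subseteq>\<^sup>* B)"
    then have "Y \<subseteq> almost_escaping B" using Y unfolding almost_escaping_def by blast
    then show False using Y almost_escaping_in_ideal[OF that] mathias_ideal_subset by blast
  qed
  then show "\<exists>\<A>. (\<A> \<subseteq> infinite_sets \<and> (\<forall>B\<in>U. \<exists>A\<in>\<A>. A \<subseteq>\<^sup>* B)) \<and> |\<A>| \<le>o |Y|"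
    using Y card_of_mono1[OF subset_refl] by (intro exI[of _ Y]) simp
qed

section \<open>Cofinality and the \<sigma>-character\<close>

lemma no_countable_base:
  assumes "countable \<B>" "\<B> \<subseteq> U"
  shows "\<exists>B\<in>U. \<forall>A\<in>\<B>. \<not> A \<subseteq>\<^sup>* B"
proof (cases "\<B> = {}")
  case False
  then have r: "range (from_nat_into \<B>) = \<B>" using range_from_nat_into[OF _ assms(1)] by simp
  define V where "V n = (\<Inter>i\<in>{..n}. from_nat_into \<B> i)" for n
  have "V n \<in> U" for n unfolding V_def
    by (rule INT_in) (use assms(2) r in auto)
  then have "\<exists>m\<ge>n. m \<in> V n" for n using infinite_in by (meson infinite_nat_iff_unbounded_le)
  then obtain b where b: "\<And>n. n \<le> b n" "\<And>n. b n \<in> V n" by metis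
  have "infinite (range b)"
    using b(1) unfolding infinite_nat_iff_unbounded_le by blast
  then obtain B where B: "B \<in> U" "infinite (range b - B)"
    using splits by metis
  have "range b \<subseteq>\<^sup>* A" if "A \<in> \<B>" for A
  proof -
    have "A \<in> range (from_nat_into \<B>)" using that r by simp
    then obtain i where i: "A = from_nat_into \<B> i" by (rule rangeE)
    have "b n \<in> A" if "n \<ge> i" for n using b(2)[of n] that unfolding V_def i by blast
    then have "range b - A \<subseteq> b ` {..<i}" by (auto intro!: imageI) (metis not_le)
    then show ?thesis unfolding almost_subset_def using finite_subset by blast
  qed
  then have "\<not> A \<subseteq>\<^sup>* B" if "A \<in> \<B>" for A
    using B(2) that almost_subset_trans unfolding almost_subset_def by blast
  then show ?thesis using B(1) by blast
qed (use UNIV_in in blast)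

text \<open>Outside P-points, a member of the ideal given by \<open>T\<close> is captured by three
  data: an \<open>\<A>'\<close> refining \<open>range T\<close>, a \<open>D\<close> such that
  \<open>d D\<close> eventually bounds the indices and finite errors of that refinement, and a
  \<open>k\<close> for the finitely many exceptions.\<close>

lemma cof_le_sigma_character: "ideal_cof (mathias_ideal U) \<le>o sigma_character U"
  unfolding ideal_cof_def sigma_character_def
proof (rule min_card_leI[OF ideal_cof_exists[OF U] sigma_character_exists[OF U]])
  fix \<A> assume "(\<forall>\<A>'\<in>\<A>. countable \<A>' \<and> \<A>' \<subseteq> U) \<and>
     (\<forall>\<B>. countable \<B> \<and> \<B> \<subseteq> U \<longrightarrow> (\<exists>\<A>'\<in>\<A>. \<forall>B\<in>\<B>. \<exists>A\<in>\<A>'. A \<subseteq>\<^sup>* B))"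
  then have ctbl: "\<And>\<A>'. \<A>' \<in> \<A> \<Longrightarrow> countable \<A>'" and sub: "\<And>\<A>'. \<A>' \<in> \<A> \<Longrightarrow> \<A>' \<subseteq> U"
    and refine: "\<And>\<B>. countable \<B> \<Longrightarrow> \<B> \<subseteq> U \<Longrightarrow> \<exists>\<A>'\<in>\<A>. \<forall>B\<in>\<B>. \<exists>A\<in>\<A>'. A \<subseteq>\<^sup>* B"
    by blast+
  have base: "\<exists>A\<in>\<Union>\<A>. A \<subseteq>\<^sup>* B" if "B \<in> U" for B
    using refine[of "{B}"] that by auto
  have inf: "infinite \<A>"
  proof
    assume "finite \<A>"
    then have "countable (\<Union>\<A>)" using ctbl countable_UN[of \<A> "\<lambda>x. x"] by (simp add: countable_finite)
    then show False using no_countable_base[of "\<Union>\<A>"] sub base by blast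
  qed
  have card: "|\<Union>\<A>| \<le>o |\<A>|"
    using UN_countable_ordLeq[OF inf ordLeq_refl[OF card_of_Card_order], of "\<lambda>x. x"] ctbl by simp
  show "\<exists>F. (F \<subseteq> mathias_ideal U \<and> (\<forall>X\<in>mathias_ideal U. \<exists>Y\<in>F. X \<subseteq> Y)) \<and> |F| \<le>o |\<A>|"
  proof (cases "p_point U")
    case True
    have "\<exists>Y\<in>almost_escaping ` \<Union>\<A>. X \<subseteq> Y" if X: "X \<in> mathias_ideal U" for X
    proof -
      obtain C where C: "C \<in> U" "X \<subseteq> almost_escaping C"
        using p_point_almost_escaping[OF True X] by blast
      obtain D where "D \<in> \<Union>\<A>" "D \<subseteq>\<^sup>* C" using base[OF C(1)] by blast
      then show ?thesis using C(2) almost_escaping_mono by blast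
    qed
    moreover have "almost_escaping ` \<Union>\<A> \<subseteq> mathias_ideal U"
      using sub almost_escaping_in_ideal by blast
    moreover have "|almost_escaping ` \<Union>\<A>| \<le>o |\<A>|"
      using card_of_image card ordLeq_transitive by blast
    ultimately show ?thesis by (intro exI[of _ "almost_escaping ` \<Union>\<A>"] conjI ballI)
  next
    case False
    obtain W :: "nat \<Rightarrow> nat set" and \<Phi> and d :: "nat set \<Rightarrow> nat \<Rightarrow> nat"
      where W: "\<forall>n. W n \<in> U" and \<Phi>: "\<forall>g. \<Phi> g \<in> U"
      and d: "\<forall>B g. (\<forall>n. B \<inter> W n \<noteq> {}) \<longrightarrow> B \<subseteq>\<^sup>* \<Phi> g \<longrightarrow> (\<exists>N. \<forall>n\<ge>N. g n \<le> d B n)"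
      using not_p_point_dominating[OF False] by metis
    define bound where "bound D k n = max k (d D n)" for D k n
    \<comment> \<open>Intersecting all members up to the bound and cutting below it makes the exact
      index and error irrelevant: only upper bounds for them matter.\<close>
    define V where "V \<A>' D k n = (\<Inter>i\<in>{..bound D k n}. from_nat_into \<A>' i) - {..<bound D k n}"
      for \<A>' D k n
    define Y where "Y \<A>' D k = {A \<in> infinite_sets. \<forall>n. \<not> A - {..<n} \<subseteq> V \<A>' D k n}" for \<A>' D k
    \<comment> \<open>The empty family is excluded because \<open>from_nat_into {}\<close> need not
      take values in \<open>U\<close>.\<close>
    define F where "F = (\<Union>\<A>'\<in>\<A> - {{}}. \<Union>D\<in>\<Union>\<A>. range (Y \<A>' D))"
    have "|\<Union>D\<in>\<Union>\<A>. range (Y \<A>' D)| \<le>o |\<A>|" for \<A>'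
      by (rule UN_countable_ordLeq[OF inf card]) simp
    then have "|F| \<le>o |\<A>|" unfolding F_def
      by (intro card_of_UNION_ordLeq_infinite[OF inf] card_of_mono1) auto
    moreover have "F \<subseteq> mathias_ideal U"
    proof
      fix X assume "X \<in> F"
      then obtain \<A>' D k where X: "\<A>' \<in> \<A>" "\<A>' \<noteq> {}" "X = Y \<A>' D k" unfolding F_def by auto
      have "from_nat_into \<A>' i \<in> U" for i using from_nat_into[OF X(2)] sub[OF X(1)] by blast
      then have "V \<A>' D k n \<in> U" for n unfolding V_def by (intro tail_in INT_in) simp_all
      then show "X \<in> mathias_ideal U" unfolding X(3)
        by (rule mathias_idealI[rotated]) (auto simp: Y_def)
    qed
    moreover have "\<exists>Z\<in>F. X \<subseteq> Z" if X: "X \<in> mathias_ideal U" for X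
    proof -
      obtain T where T: "\<And>n. T n \<in> U" "\<And>A n. A \<in> X \<Longrightarrow> \<not> A - {..<n} \<subseteq> T n"
        using mathias_idealD[OF X] by metis
      obtain \<A>' where \<A>': "\<A>' \<in> \<A>" "\<forall>B\<in>range T. \<exists>A\<in>\<A>'. A \<subseteq>\<^sup>* B"
        using refine[of "range T"] T(1) by auto
      then have ne: "\<A>' \<noteq> {}" by blast
      have "\<exists>i m. from_nat_into \<A>' i - {..<m} \<subseteq> T n" for n
        using \<A>' from_nat_into_surj[OF ctbl[OF \<A>'(1)]] unfolding almost_subset_bound
        by (metis rangeI)
      then obtain i m where im: "\<And>n. from_nat_into \<A>' (i n) - {..<m n} \<subseteq> T n" by metis
      define g where "g n = max (i n) (m n)" for n
      obtain D where D: "D \<in> \<Union>\<A>" "D \<subseteq>\<^sup>* \<Phi> g" using base[of "\<Phi> g"] \<Phi> by blast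
      have "D \<in> U" using D(1) sub by blast
      then have "D \<inter> W n \<noteq> {}" for n using Int_in[of D "W n"] W empty_notin by auto
      then obtain N where N: "\<forall>n\<ge>N. g n \<le> d D n" using d[rule_format, of D g] D(2) by blast
      obtain k where k: "\<forall>n<N. g n \<le> k"
        using finite_nat_set_iff_bounded_le[of "g ` {..<N}"] by auto
      have "g n \<le> bound D k n" for n
        using N k unfolding bound_def by (cases "n < N") (auto simp: le_max_iff_disj)
      then have "i n \<le> bound D k n" "m n \<le> bound D k n" for n
        unfolding g_def by (metis max.boundedE)+
      then have "V \<A>' D k n \<subseteq> from_nat_into \<A>' (i n) - {..<m n}" for n
        unfolding V_def by (intro Diff_mono INT_lower) simp_all
      then have le: "V \<A>' D k n \<subseteq> T n" for n by (rule subset_trans[OF _ im])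
      have "\<not> A - {..<n} \<subseteq> V \<A>' D k n" if "A \<in> X" for A n
        using T(2)[OF that, of n] subset_trans[OF _ le[of n]] by blast
      then have "X \<subseteq> Y \<A>' D k" using mathias_ideal_infinite_sets[OF X] unfolding Y_def by blast
      moreover have "Y \<A>' D k \<in> F" unfolding F_def using \<A>'(1) ne D(1) by blast
      ultimately show ?thesis by blast
    qed
    ultimately show ?thesis by (intro exI[of _ F] conjI ballI)
  qed
qed

lemma sigma_character_le_cof: "sigma_character U \<le>o ideal_cof (mathias_ideal U)"
  unfolding ideal_cof_def sigma_character_def
proof (rule min_card_leI[OF sigma_character_exists[OF U] ideal_cof_exists[OF U]])
  fix F assume F: "F \<subseteq> mathias_ideal U \<and> (\<forall>X\<in>mathias_ideal U. \<exists>Y\<in>F. X \<subseteq> Y)"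
  have "\<forall>X\<in>F. \<exists>V. (\<forall>n. V n \<in> U) \<and> (\<forall>A\<in>X. \<forall>n. \<not> A - {..<n} \<subseteq> V n)"
    using F mathias_idealD by blast
  then obtain V where V: "\<And>X n. X \<in> F \<Longrightarrow> V X n \<in> U"
      "\<And>X A n. X \<in> F \<Longrightarrow> A \<in> X \<Longrightarrow> \<not> A - {..<n} \<subseteq> V X n"
    by metis
  \<comment> \<open>\<open>- C\<close> supplies infinitely many indices for the sets to be refined
    while itself lying outside \<open>U\<close>.\<close>
  obtain C where C: "C \<in> U" "infinite (- C)"
    using splits[OF infinite_UNIV_nat] by (metis Compl_eq_Diff_UNIV)
  have "\<exists>X\<in>F. \<forall>B\<in>\<B>. \<exists>A\<in>range (V X). A \<subseteq>\<^sup>* B" if \<B>: "countable \<B>" "\<B> \<subseteq> U" for \<B>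
  proof -
    \<comment> \<open>\<open>UNIV\<close> is inserted so that the enumerated family is nonempty.
      Values in \<open>U\<close> are required at all indices, also those in \<open>C\<close>, since
      \<open>T n\<close> below intersects every \<open>B m\<close> with
      \<open>m < n\<close>.\<close>
    obtain B where B: "range B \<subseteq> U" "\<B> \<subseteq> B ` (- C)"
    proof -
      let ?\<B> = "insert UNIV \<B>"
      let ?B = "from_nat_into ?\<B> \<circ> to_nat_on (- C)"
      have ctbl: "countable ?\<B>" using \<B>(1) by simp
      have "?B ` (- C) = from_nat_into ?\<B> ` to_nat_on (- C) ` (- C)" by (simp only: image_comp)
      moreover have "to_nat_on (- C) ` (- C) = UNIV"
        using bij_betw_imp_surj_on[OF to_nat_on_infinite[OF _ C(2)]] by simp
      moreover have "range (from_nat_into ?\<B>) = ?\<B>" using range_from_nat_into[OF _ ctbl] by blast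
      ultimately have "?B ` (- C) = ?\<B>" by metis
      then have "\<B> \<subseteq> ?B ` (- C)" by (metis subset_insertI)
      moreover have "from_nat_into ?\<B> i \<in> U" for i using from_nat_into[of ?\<B> i] \<B>(2) UNIV_in by auto
      then have "range ?B \<subseteq> U" by auto
      ultimately show thesis using that by blast
    qed
    \<comment> \<open>The minimum of a set in \<open>Z\<close> says which \<open>B n\<close> the set escapes; letting it range over \<open>- C\<close>
      only keeps \<open>Z\<close> in the ideal even if the \<open>B n\<close> have no pseudointersection in \<open>U\<close>.\<close>
    define Z where "Z = {A \<in> infinite_sets. Inf A \<notin> C \<and> \<not> A \<subseteq>\<^sup>* B (Inf A)}"
    have "Z \<in> mathias_ideal U"
    proof -
      define T where "T n = C \<inter> (\<Inter>m\<in>{..<n}. B m)" for n :: nat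
      have "\<not> A - {..<n} \<subseteq> T n" if "A \<in> Z" for A n
      proof
        assume le: "A - {..<n} \<subseteq> T n"
        have A: "Inf A \<in> A" "Inf A \<notin> C" "\<not> A \<subseteq>\<^sup>* B (Inf A)"
          using that Inf_nat_def1[of A] unfolding Z_def infinite_sets_def by auto
        \<comment> \<open>A minimum not below \<open>n\<close> would lie in \<open>T n\<close>,
          hence in \<open>C\<close>.\<close>
        then have "Inf A < n" using le unfolding T_def by auto
        then have "A - {..<n} \<subseteq> B (Inf A)" using le unfolding T_def by blast
        then show False using A(3) unfolding almost_subset_bound by blast
      qed
      moreover have "T n \<in> U" for n unfolding T_def using B(1) by (intro Int_in C(1) INT_in) auto
      moreover have "Z \<subseteq> infinite_sets" unfolding Z_def by blast
      ultimately show ?thesis by (intro mathias_idealI[of Z T])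
    qed
    then obtain X where X: "X \<in> F" "Z \<subseteq> X" using F by blast
    have "V X (Suc n) \<subseteq>\<^sup>* B n" if "n \<notin> C" for n
    proof -
      \<comment> \<open>Adding \<open>n\<close> makes it the minimum, which selects
        \<open>B n\<close>. The index is \<open>Suc n\<close> because the cut has to remove
        \<open>n\<close> itself, which may lie outside \<open>V X (Suc n)\<close>.\<close>
      let ?A = "insert n (V X (Suc n) - {..<Suc n})"
      have "Inf ?A = n" by (rule cInf_eq_minimum) auto
      moreover have "?A \<in> infinite_sets"
        using infinite_in[OF tail_in[OF V(1)[OF X(1)]], of "Suc n" "Suc n"]
        unfolding infinite_sets_def by simp
      moreover have "?A - {..<Suc n} \<subseteq> V X (Suc n)" by auto
      then have "?A \<notin> Z" using V(2)[OF X(1)] X(2) by blast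
      ultimately have "?A \<subseteq>\<^sup>* B n" using that unfolding Z_def by auto
      moreover have "V X (Suc n) \<subseteq>\<^sup>* ?A" unfolding almost_subset_bound by blast
      ultimately show ?thesis using almost_subset_trans by blast
    qed
    then show ?thesis using B(2) X(1) by blast
  qed
  then have "\<forall>\<B>. countable \<B> \<and> \<B> \<subseteq> U \<longrightarrow>
      (\<exists>\<A>'\<in>(\<lambda>X. range (V X)) ` F. \<forall>B\<in>\<B>. \<exists>A\<in>\<A>'. A \<subseteq>\<^sup>* B)" by simp
  moreover have "\<forall>\<A>'\<in>(\<lambda>X. range (V X)) ` F. countable \<A>' \<and> \<A>' \<subseteq> U" using V(1) by auto
  ultimately show "\<exists>\<A>. ((\<forall>\<A>'\<in>\<A>. countable \<A>' \<and> \<A>' \<subseteq> U) \<and>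
     (\<forall>\<B>. countable \<B> \<and> \<B> \<subseteq> U \<longrightarrow> (\<exists>\<A>'\<in>\<A>. \<forall>B\<in>\<B>. \<exists>A\<in>\<A>'. A \<subseteq>\<^sup>* B))) \<and> |\<A>| \<le>o |F|"
    by (intro exI[of _ "(\<lambda>X. range (V X)) ` F"] conjI card_of_image)
qed

end

theorem theorem1:
  fixes U :: "nat set set"
  assumes "nonprincipal_ultrafilter U"
  shows "ideal_add (mathias_ideal U) =o p_number U
       \<and> ideal_cov infinite_sets (mathias_ideal U) =o pi_p_number U
       \<and> ideal_non infinite_sets (mathias_ideal U) =o pi_character U
       \<and> ideal_cof (mathias_ideal U) =o sigma_character U"
  by (intro conjI ordIso_iff_ordLeq[THEN iffD2] add_le_p p_le_add cov_le_pi_p pi_p_le_cov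
      non_le_pi_character pi_character_le_non cof_le_sigma_character sigma_character_le_cof assms)

end
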